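(* Let $*$ be any one of the four binary connectives $\to$, $\rightharpoonup$, $\leftharpoonup$, $\rightleftharpoons$. For $n\ge 1$ let $a_n$ and $b_n$ be the numbers of rows with the value false and true, respectively, in the truth tables of all bracketed formulae with $n$ distinct variables $p_1,\dots,p_n$ connected by $*$. Let $$z_n^{\#1}=\sum_{i=1}^{n-1}a_i a_{n-i},\quad z_n^{\#2}=\sum_{i=1}^{n-1}a_i b_{n-i},\quad z_n^{\#3}=\sum_{i=1}^{n-1}b_i a_{n-i},\quad z_n^{\#4}=\sum_{i=1}^{n-1}b_i b_{n-i}.$$ Then for each $j=1,2,3,4$ the sequence $z_n^{\#j}$ preserves the parity of the Catalan numbers; that is, for every $n\geq 2$, $z_n^{\#j}$ is odd if and only if $C_n$ is odd.
   Context: Here $C_n=\frac1n\binom{2n-2}{n-1}$ for $n\ge1$. The connectives are: $\psi\to\phi$, ordinary implication (false exactly when $\psi$ is true and $\phi$ is false); $\psi\rightharpoonup\phi\equiv\psi\to\neg\phi$ (false exactly when $\psi$ and $\phi$ are both true); $\psi\leftharpoonup\phi\equiv\neg\psi\to\phi$ (false exactly when both are false); $\psi\rightleftharpoons\phi\equiv\neg\psi\to\neg\phi$ (false exactly when $\psi$ is false and $\phi$ is true). A bracketed formula with $n$ variables is obtained from $p_1*p_2*\cdots*p_n$ (variables in this fixed order) by fully inserting brackets; for $n=1$ it is $p_1$. A row is a pair consisting of such a bracketed formula and a valuation of $p_1,\dots,p_n$ in $\{\text{false},\text{true}\}$; its value is the truth value of the formula under the valuation. In particular $a_n+b_n=2^nC_n$.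 *)

theory Defs
  imports Complex_Main "HOL-Library.FuncSet"
begin

definition catalan :: "nat \<Rightarrow> nat" where
  "catalan n = ((2 * n - 2) choose (n - 1)) div n"

text \<open>The natural-number division in \<^const>\<open>catalan\<close> is exact.\<close>

lemma catalan_exact:
  assumes "n \<ge> 1"
  shows "n * catalan n = (2 * n - 2) choose (n - 1)"
proof -
  obtain m where n: "n = Suc m"
    using assms by (cases n) auto
  have "Suc m * (2 * m choose Suc m) = m * (2 * m choose m)"
  proof (cases m)
    case (Suc k)
    then show ?thesis
      using Suc_times_binomial_add[of m k] by (simp add: mult_2)
  qed simp
  then have "Suc m dvd m * (2 * m choose m)"
    by (metis dvd_triv_left)
  then have "Suc m dvd (2 * m choose m)"
    using coprime_dvd_mult_right_iff[of "Suc m" m] by simp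
  then show ?thesis
    unfolding catalan_def n by (simp add: dvd_mult_div_cancel del: mult_Suc)
qed

definition imp :: "bool \<Rightarrow> bool \<Rightarrow> bool" where  \<comment> \<open>\<open>\<psi> \<rightarrow> \<phi>\<close>\<close>
  "imp \<psi> \<phi> \<longleftrightarrow> (\<psi> \<longrightarrow> \<phi>)"

definition imp_neg :: "bool \<Rightarrow> bool \<Rightarrow> bool" where  \<comment> \<open>\<open>\<psi> \<rightharpoonup> \<phi>\<close>\<close>
  "imp_neg \<psi> \<phi> \<longleftrightarrow> (\<psi> \<longrightarrow> \<not> \<phi>)"

definition neg_imp :: "bool \<Rightarrow> bool \<Rightarrow> bool" where  \<comment> \<open>\<open>\<psi> \<leftharpoonup> \<phi>\<close>\<close>
  "neg_imp \<psi> \<phi> \<longleftrightarrow> (\<not> \<psi> \<longrightarrow> \<phi>)"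

definition neg_imp_neg :: "bool \<Rightarrow> bool \<Rightarrow> bool" where  \<comment> \<open>\<open>\<psi> \<rightleftharpoons> \<phi>\<close>\<close>
  "neg_imp_neg \<psi> \<phi> \<longleftrightarrow> (\<not> \<psi> \<longrightarrow> \<not> \<phi>)"

text \<open>Formulae over a single binary connective symbol; \<open>Var i\<close> is the variable \<open>p\<^sub>i\<close>.
  The truth function of the connective is a parameter of the evaluation.\<close>

datatype formula = Var nat | Conn formula formula

fun vars :: "formula \<Rightarrow> nat list" where
  "vars (Var i) = [i]"
| "vars (Conn \<psi> \<phi>) = vars \<psi> @ vars \<phi>"

fun eval_formula :: "(bool \<Rightarrow> bool \<Rightarrow> bool) \<Rightarrow> (nat \<Rightarrow> bool) \<Rightarrow> formula \<Rightarrow> bool" where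
  "eval_formula c v (Var i) = v i"
| "eval_formula c v (Conn \<psi> \<phi>) = c (eval_formula c v \<psi>) (eval_formula c v \<phi>)"

text \<open>A full bracketing of \<open>p\<^sub>1 * \<dots> * p\<^sub>n\<close> is a formula whose
  left-to-right list of variables is \<open>p\<^sub>1, \<dots>, p\<^sub>n\<close>.\<close>

definition bracketed :: "nat \<Rightarrow> formula set" where
  "bracketed n = {\<phi>. vars \<phi> = [1..<Suc n]}"

text \<open>Valuations are extensional functions, so that each assignment of truth values to
  \<open>p\<^sub>1, \<dots>, p\<^sub>n\<close> is counted exactly once.\<close>

definition rows :: "nat \<Rightarrow> (formula \<times> (nat \<Rightarrow> bool)) set" where
  "rows n = bracketed n \<times> ({1..n} \<rightarrow>\<^sub>E UNIV)"

definition false_rows :: "(bool \<Rightarrow> bool \<Rightarrow> bool) \<Rightarrow> nat \<Rightarrow> nat" where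
  "false_rows c n = card {(\<phi>, v) \<in> rows n. \<not> eval_formula c v \<phi>}"

definition true_rows :: "(bool \<Rightarrow> bool \<Rightarrow> bool) \<Rightarrow> nat \<Rightarrow> nat" where
  "true_rows c n = card {(\<phi>, v) \<in> rows n. eval_formula c v \<phi>}"

end

(* A row is the same thing as a binary tree with Boolean leaves, and splitting trees at the root
   gives convolution recurrences for a_n and b_n.  They show by induction that a_n + b_n is even,
   so the four convolutions z_n have the same parity.  As the connective is false for exactly one
   pair of arguments, a_n itself is one of the four.  A self-convolution pairs the index i with n - i,
   so for n >= 2 the number a_n is odd iff n is even and a_(n/2) is odd.  The Catalan numbers obey
   the same rule, because (2n-1) C_n = binomial(2n-1, n). *)
theory Submission
  imports Defs
begin

section \<open>Parity of sums and binomial coefficients\<close>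

lemma even_sum_cong:
  fixes f g :: "'a \<Rightarrow> nat"
  assumes "\<And>x. x \<in> A \<Longrightarrow> even (f x) \<longleftrightarrow> even (g x)"
  shows "even (sum f A) \<longleftrightarrow> even (sum g A)"
  using assms by (induction A rule: infinite_finite_induct) auto

text \<open>The reflection of \<open>i\<close> to \<open>n - i\<close> leaves the summand unchanged,
  so terms off the midpoint cancel in pairs modulo 2. Only the square of \<open>f (n div 2)\<close>
  can survive, and it occurs just for even \<open>n\<close>.\<close>

lemma odd_self_convolution_iff:
  fixes f :: "nat \<Rightarrow> nat"
  assumes "n \<ge> 2"
  shows "odd (\<Sum>i = 1..n - 1. f i * f (n - i)) \<longleftrightarrow> even n \<and> odd (f (n div 2))"
proof -
  let ?g = "\<lambda>i. f i * f (n - i)"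
  let ?L = "{i \<in> {1..n - 1}. 2 * i < n}"
  let ?M = "{i \<in> {1..n - 1}. 2 * i = n}"
  let ?R = "{i \<in> {1..n - 1}. 2 * i > n}"
  have "{1..n - 1} = ?L \<union> ?R \<union> ?M"
    by auto
  then have "sum ?g {1..n - 1} = sum ?g (?L \<union> ?R \<union> ?M)"
    by (rule arg_cong)
  also have "\<dots> = sum ?g (?L \<union> ?R) + sum ?g ?M"
    by (rule sum.union_disjoint) auto
  also have "sum ?g (?L \<union> ?R) = sum ?g ?L + sum ?g ?R"
    by (rule sum.union_disjoint) auto
  also have "sum ?g ?R = sum ?g ?L"
    by (rule sum.reindex_bij_witness[of _ "\<lambda>i. n - i" "\<lambda>i. n - i"]) auto
  finally have "odd (sum ?g {1..n - 1}) \<longleftrightarrow> odd (sum ?g ?M)"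
    by simp
  also have "\<dots> \<longleftrightarrow> even n \<and> odd (f (n div 2))"
  proof (cases "even n")
    case True
    then obtain k where n: "n = 2 * k"
      by blast
    with assms have "?M = {k}"
      by auto
    with n show ?thesis
      by simp
  next
    case False
    then have "?M = {}"
      by auto
    with False show ?thesis
      by (simp only: sum.empty) simp
  qed
  finally show ?thesis .
qed

section \<open>Parity of binomial coefficients and Catalan numbers\<close>

lemma even_binomial_even_odd: "even ((2 * a) choose (2 * b + 1))"
proof (cases a)
  case (Suc m)
  have "Suc (2 * b) * ((2 * a) choose Suc (2 * b)) = 2 * a * ((2 * a - 1) choose (2 * b))"
    by (rule binomial_absorption)
  then have "even (Suc (2 * b) * ((2 * a) choose Suc (2 * b)))"
    by (metis dvd_mult2 dvd_triv_left)
  then show ?thesis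
    by (simp del: mult_Suc binomial_Suc_Suc)
qed simp

text \<open>A case of Lucas's theorem modulo 2, reflecting (1 + x)^(2a) = (1 + x^2)^a. Two Pascal
  steps in row \<open>2 * a\<close> produce the middle term twice, so modulo 2 they act as one
  Pascal step in row \<open>a\<close>.\<close>

lemma even_binomial_double: "even ((2 * a) choose (2 * b)) \<longleftrightarrow> even (a choose b)"
proof (induction a arbitrary: b)
  case 0
  then show ?case
    by (cases b) auto
next
  case (Suc a)
  show ?case
  proof (cases b)
    case (Suc d)
    have "(2 * Suc a) choose (2 * b) =
        ((2 * a) choose (2 * d)) + 2 * ((2 * a) choose (2 * d + 1)) + ((2 * a) choose (2 * Suc d))"
      using Suc by simp
    with Suc.IH[of d] Suc.IH[of "Suc d"] Suc show ?thesis
      by (simp del: mult_Suc_right)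
  qed simp
qed

text \<open>As \<open>2 * n - 1\<close> is odd, this gives the Catalan number the parity of a single
  binomial coefficient, with no division left.\<close>

lemma catalan_binomial:
  assumes "n \<ge> 1"
  shows "(2 * n - 1) * catalan n = (2 * n - 1) choose n"
proof -
  obtain m where n: "n = Suc m"
    using assms by (cases n) auto
  have "n * ((2 * n - 1) choose n) = (2 * n - 1) * ((2 * n - 2) choose (n - 1))"
    using binomial_absorption[of m "2 * n - 1"] unfolding n by (simp del: binomial_Suc_Suc)
  also have "\<dots> = n * ((2 * n - 1) * catalan n)"
    using catalan_exact[OF assms] by (simp add: mult_ac)
  finally show ?thesis
    using assms by simp
qed

text \<open>Pascal's rule makes it the sum of the two middle entries of the row above, which are
  equal by symmetry.\<close>

lemma even_central_binomial:
  assumes "k \<ge> 1"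
  shows "even ((2 * k) choose k)"
proof -
  obtain m where k: "k = Suc m"
    using assms by (cases k) auto
  have "(2 * m + 1) choose m = (2 * m + 1) choose Suc m"
    using binomial_symmetric[of m "2 * m + 1"] by simp
  then have "(2 * k) choose k = 2 * ((2 * m + 1) choose m)"
    unfolding k by simp
  then show ?thesis
    by simp
qed

lemma odd_catalan_iff:
  assumes "n \<ge> 2"
  shows "odd (catalan n) \<longleftrightarrow> even n \<and> odd (catalan (n div 2))"
proof (cases "even n")
  case True
  have cat: "odd (catalan m) \<longleftrightarrow> odd ((2 * m - 1) choose m)" if "m \<ge> 1" for m
  proof -
    have "odd (2 * m - 1)"
      using that by simp
    then show ?thesis
      using catalan_binomial[OF that] by (metis even_mult_iff)
  qed
  obtain k where n: "n = 2 * k"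
    using True by blast
  then obtain m where k: "k = Suc m"
    using assms by (cases k) auto
  have "2 * n - 1 = Suc (2 * (2 * m + 1))" and "n = Suc (2 * m + 1)"
    unfolding n k by simp_all
  \<comment> \<open>Pascal's rule moves to an even row. The first summand has an odd lower index and
    is even; the second can be halved to \<open>(2 * m + 1) choose k\<close>, which has the parity
    of \<open>catalan k\<close>.\<close>
  then have "(2 * n - 1) choose n =
      ((2 * (2 * m + 1)) choose (2 * m + 1)) + ((2 * (2 * m + 1)) choose (2 * k))"
    unfolding k by (simp only: binomial_Suc_Suc) simp
  then have "odd ((2 * n - 1) choose n) \<longleftrightarrow> odd ((2 * m + 1) choose k)"
    using even_binomial_even_odd[of "2 * m + 1" m] even_binomial_double[of "2 * m + 1" k]
    by presburger
  moreover have "2 * k - 1 = 2 * m + 1"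
    unfolding k by simp
  ultimately show ?thesis
    using cat[of n] cat[of k] assms n by simp
next
  case False
  \<comment> \<open>The product is a central binomial coefficient with \<open>n - 1 \<ge> 1\<close>,
    and the factor \<open>n\<close> is odd.\<close>
  have "even (n * catalan n)"
    using even_central_binomial[of "n - 1"] assms catalan_exact[of n]
    by (simp add: right_diff_distrib')
  with False show ?thesis
    by simp
qed

section \<open>Rows as Boolean trees\<close>

datatype bool_tree = Leaf bool | Node bool_tree bool_tree

fun leaf_count :: "bool_tree \<Rightarrow> nat" where
  "leaf_count (Leaf b) = 1"
| "leaf_count (Node l r) = leaf_count l + leaf_count r"

fun tree_value :: "(bool \<Rightarrow> bool \<Rightarrow> bool) \<Rightarrow> bool_tree \<Rightarrow> bool" where
  "tree_value c (Leaf b) = b"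
| "tree_value c (Node l r) = c (tree_value c l) (tree_value c r)"

fun instantiate :: "(nat \<Rightarrow> bool) \<Rightarrow> formula \<Rightarrow> bool_tree" where
  "instantiate v (Var i) = Leaf (v i)"
| "instantiate v (Conn \<psi> \<phi>) = Node (instantiate v \<psi>) (instantiate v \<phi>)"

fun leaves :: "bool_tree \<Rightarrow> bool list" where
  "leaves (Leaf b) = [b]"
| "leaves (Node l r) = leaves l @ leaves r"

text \<open>Recovers the formula of a row; \<open>k\<close> is the index of the leftmost variable,
  which for a right subtree depends on the size of the left one.\<close>

fun tree_formula :: "nat \<Rightarrow> bool_tree \<Rightarrow> formula" where
  "tree_formula k (Leaf b) = Var k"
| "tree_formula k (Node l r) = Conn (tree_formula k l) (tree_formula (k + leaf_count l) r)"

definition value_trees :: "(bool \<Rightarrow> bool \<Rightarrow> bool) \<Rightarrow> bool \<Rightarrow> nat \<Rightarrow> bool_tree set" where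
  "value_trees c s n = {t. leaf_count t = n \<and> tree_value c t = s}"

section \<open>The bijection between rows and trees\<close>

lemma length_leaves: "length (leaves t) = leaf_count t"
  by (induction t) auto

lemma leaf_count_pos: "leaf_count t \<ge> 1"
  by (induction t) auto

lemma leaves_instantiate: "leaves (instantiate v \<phi>) = map v (vars \<phi>)"
  by (induction \<phi>) auto

lemma tree_value_instantiate: "tree_value c (instantiate v \<phi>) = eval_formula c v \<phi>"
  by (induction \<phi>) auto

lemma leaf_count_instantiate: "leaf_count (instantiate v \<phi>) = length (vars \<phi>)"
  by (induction \<phi>) auto

lemma upt_add_add: "[k..<k + (a + b)] = [k..<k + a] @ [k + a..<k + a + b]"
  using upt_add_eq_append[of k "k + a" b] by (simp add: add.assoc)

lemma vars_tree_formula: "vars (tree_formula k t) = [k..<k + leaf_count t]"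
  by (induction k t rule: tree_formula.induct) (simp_all add: upt_add_add)

lemma instantiate_tree_formula:
  "map v [k..<k + leaf_count t] = leaves t \<Longrightarrow> instantiate v (tree_formula k t) = t"
proof (induction k t rule: tree_formula.induct)
  case (2 k l r)
  have "map v [k..<k + leaf_count l] @ map v [k + leaf_count l..<k + leaf_count l + leaf_count r]
      = leaves l @ leaves r"
    using "2.prems" by (simp add: upt_add_add)
  then have "map v [k..<k + leaf_count l] = leaves l"
    "map v [k + leaf_count l..<k + leaf_count l + leaf_count r] = leaves r"
    by (auto simp: append_eq_append_conv length_leaves)
  with "2.IH" show ?case
    by simp
qed simp

text \<open>The start \<open>k\<close> is arbitrary because the variables of a right subformula do
  not begin at 1. Comparing lengths cuts the interval of indices where the two variable lists
  meet.\<close>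

lemma tree_formula_instantiate:
  "vars \<phi> = [k..<k + m] \<Longrightarrow> tree_formula k (instantiate v \<phi>) = \<phi>"
proof (induction \<phi> arbitrary: k m)
  case (Var i)
  then have "[i] = [k..<k + m]"
    by simp
  then have "i = k"
    by (metis list.inject upt_eq_Cons_conv)
  then show ?case
    by simp
next
  case (Conn \<psi> \<phi>)
  define a b where "a = length (vars \<psi>)" and "b = length (vars \<phi>)"
  have "length (vars (Conn \<psi> \<phi>)) = m"
    unfolding Conn.prems by simp
  then have "m = a + b"
    by (simp add: a_def b_def)
  then have "vars \<psi> @ vars \<phi> = [k..<k + a] @ [k + a..<k + a + b]"
    using Conn.prems by (simp add: upt_add_add)
  moreover have "length (vars \<psi>) = length [k..<k + a]"
    by (simp add: a_def)
  ultimately have "vars \<psi> = [k..<k + a]" "vars \<phi> = [k + a..<k + a + b]"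
    using append_eq_append_conv by blast+
  with Conn.IH show ?case
    by (simp add: leaf_count_instantiate)
qed

lemma card_rows_value:
  "card {(\<phi>, v) \<in> rows n. eval_formula c v \<phi> = s} = card (value_trees c s n)"
proof -
  let ?A = "{(\<phi>, v) \<in> rows n. eval_formula c v \<phi> = s}"
  let ?f = "\<lambda>(\<phi>, v). instantiate v \<phi>"
  \<comment> \<open>Variables count from 1 and list positions from 0, hence \<open>i - 1\<close>.
    The restriction to \<open>{1..n}\<close> makes the valuation extensional, so that
    \<open>?g\<close> inverts \<open>?f\<close> exactly.\<close>
  let ?g = "\<lambda>t. (tree_formula 1 t, \<lambda>i\<in>{1..n}. leaves t ! (i - 1))"
  have gf: "?g (?f x) = x" if "x \<in> ?A" for x
  proof -
    obtain \<phi> v where x: "x = (\<phi>, v)"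
      by (cases x)
    have vars: "vars \<phi> = [1..<Suc n]" and v: "v \<in> {1..n} \<rightarrow>\<^sub>E UNIV"
      using that by (auto simp: x rows_def bracketed_def)
    have "tree_formula 1 (instantiate v \<phi>) = \<phi>"
      using vars tree_formula_instantiate[of \<phi> 1 n] by simp
    moreover have "(\<lambda>i\<in>{1..n}. leaves (instantiate v \<phi>) ! (i - 1)) = v"
    proof
      fix i
      show "(\<lambda>i\<in>{1..n}. leaves (instantiate v \<phi>) ! (i - 1)) i = v i"
        using v by (auto simp: leaves_instantiate vars PiE_def extensional_def simp del: upt_Suc)
    qed
    ultimately show ?thesis
      by (simp add: x)
  qed
  have fg: "?f (?g t) = t" and g: "?g t \<in> rows n" if "leaf_count t = n" for t
  proof -
    have "map (\<lambda>i\<in>{1..n}. leaves t ! (i - 1)) [1..<1 + leaf_count t] = leaves t"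
      using that by (intro nth_equalityI) (auto simp: length_leaves simp del: upt_Suc)
    then show "?f (?g t) = t"
      using instantiate_tree_formula by simp
    show "?g t \<in> rows n"
      using that by (simp add: rows_def bracketed_def vars_tree_formula del: upt_Suc)
  qed
  have "bij_betw ?f ?A (value_trees c s n)"
  proof (rule bij_betw_byWitness[where f' = ?g])
    show "\<forall>x\<in>?A. ?g (?f x) = x"
      using gf by blast
    show "\<forall>t\<in>value_trees c s n. ?f (?g t) = t"
      using fg by (auto simp: value_trees_def)
    show "?f ` ?A \<subseteq> value_trees c s n"
      by (auto simp: value_trees_def rows_def bracketed_def tree_value_instantiate
          leaf_count_instantiate)
    show "?g ` value_trees c s n \<subseteq> ?A"
    proof
      fix x
      assume "x \<in> ?g ` value_trees c s n"
      then obtain t where x: "x = ?g t" and t: "leaf_count t = n" "tree_value c t = s"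
        by (auto simp: value_trees_def)
      \<comment> \<open>Evaluating the rebuilt row amounts to evaluating \<open>?f (?g t)\<close>,
        which is \<open>t\<close> itself.\<close>
      have "eval_formula c (snd (?g t)) (fst (?g t)) = tree_value c (?f (?g t))"
        by (simp add: tree_value_instantiate)
      with fg[OF t(1)] g[OF t(1)] t(2) show "x \<in> ?A"
        unfolding x by auto
    qed
  qed
  then show ?thesis
    by (rule bij_betw_same_card)
qed

section \<open>Recurrences from splitting trees at the root\<close>

lemma value_trees_1: "value_trees c s 1 = {Leaf s}"
proof -
  have "t = Leaf (tree_value c t)" if "leaf_count t = 1" for t
  proof (cases t)
    case (Node l r)
    with that leaf_count_pos[of l] leaf_count_pos[of r] show ?thesis
      by simp
  qed simp
  then show ?thesis
    unfolding value_trees_def by fastforce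
qed

text \<open>The index records the size of the left subtree and the truth values of both subtrees. A
  tree determines all three, so the decomposition is unique and each fibre is a full
  product.\<close>

lemma value_trees_split:
  assumes "n \<ge> 2"
  shows "bij_betw (\<lambda>(_, l, r). Node l r)
    (SIGMA x : {1..n - 1} \<times> {(p, q). c p q = s}.
      value_trees c (fst (snd x)) (fst x) \<times> value_trees c (snd (snd x)) (n - fst x))
    (value_trees c s n)" (is "bij_betw ?f ?A _")
proof (rule bij_betw_imageI)
  show "inj_on ?f ?A"
    by (auto simp: inj_on_def value_trees_def)
  show "?f ` ?A = value_trees c s n"
  proof
    show "?f ` ?A \<subseteq> value_trees c s n"
      by (auto simp: value_trees_def)
    show "value_trees c s n \<subseteq> ?f ` ?A"
    proof
      fix t
      assume t: "t \<in> value_trees c s n"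
      then obtain l r where lr: "t = Node l r"
        using assms by (cases t) (auto simp: value_trees_def)
      have "((leaf_count l, tree_value c l, tree_value c r), l, r) \<in> ?A"
        using t lr leaf_count_pos[of l] leaf_count_pos[of r] by (auto simp: value_trees_def)
      then show "t \<in> ?f ` ?A"
        unfolding lr by (rule rev_image_eqI) simp
    qed
  qed
qed

text \<open>Needed to turn the splitting bijection into an equation of cardinalities. The same
  bijection reduces finiteness to smaller trees.\<close>

lemma finite_value_trees: "finite (value_trees c s n)"
proof (induction n arbitrary: s rule: less_induct)
  case (less n)
  consider "n = 0" | "n = 1" | "n \<ge> 2"
    by linarith
  then show ?case
  proof cases
    case 1
    have no_leaves: "leaf_count t \<noteq> 0" for t
      using leaf_count_pos[of t] by simp
    show ?thesis
      by (simp add: 1 value_trees_def no_leaves)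
  next
    case 2
    then show ?thesis
      using value_trees_1[of c s] by simp
  next
    case 3
    have "finite (value_trees c p i)" "finite (value_trees c q (n - i))"
      if "i \<in> {1..n - 1}" for p q i
      using that 3 less.IH by auto
    then show ?thesis
      unfolding bij_betw_finite[OF value_trees_split[OF 3], symmetric]
      by (intro finite_SigmaI finite_cartesian_product) auto
  qed
qed

lemma card_value_trees:
  assumes "n \<ge> 2"
  shows "card (value_trees c s n) = (\<Sum>i = 1..n - 1. \<Sum>(p, q)\<in>{(p, q). c p q = s}.
    card (value_trees c p i) * card (value_trees c q (n - i)))"
  unfolding bij_betw_same_card[OF value_trees_split[OF assms], symmetric]
  by (subst card_SigmaI)
    (auto simp: finite_value_trees card_cartesian_product sum.cartesian_product case_prod_unfold)

section \<open>Parity of the numbers of true and false trees\<close>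

lemma even_card_value_trees:
  assumes "n \<ge> 1"
  shows "even (card (value_trees c True n) + card (value_trees c False n))"
  using assms
proof (induction n rule: less_induct)
  case (less n)
  let ?N = "\<lambda>s i. card (value_trees c s i)"
  show ?case
  proof (cases "n = 1")
    case True
    then show ?thesis
      using value_trees_1[of c] by simp
  next
    case False
    with less.prems have n: "n \<ge> 2"
      by simp
    \<comment> \<open>Each pair of argument values makes the root either true or false, so the total
      over both values is the self-convolution of the totals, whatever the connective. Every factor
      is even by induction, starting from 2 at \<open>n = 1\<close>.\<close>
    have "?N True n + ?N False n =
        (\<Sum>i = 1..n - 1. (?N True i + ?N False i) * (?N True (n - i) + ?N False (n - i)))"
      unfolding card_value_trees[OF n] sum.distrib [symmetric]
    proof (rule sum.cong[OF refl])
      fix i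
      let ?h = "\<lambda>(p, q). ?N p i * ?N q (n - i)"
      have "sum ?h {(p, q). c p q = True} + sum ?h {(p, q). c p q = False}
          = sum ?h ({(p, q). c p q = True} \<union> {(p, q). c p q = False})"
        by (rule sum.union_disjoint [symmetric]) auto
      also have "{(p, q). c p q = True} \<union> {(p, q). c p q = False} = {True, False} \<times> {True, False}"
        by auto
      also have "sum ?h \<dots> = (?N True i + ?N False i) * (?N True (n - i) + ?N False (n - i))"
        by (simp add: sum.cartesian_product [symmetric] algebra_simps)
      finally show "sum ?h {(p, q). c p q = True} + sum ?h {(p, q). c p q = False}
          = (?N True i + ?N False i) * (?N True (n - i) + ?N False (n - i))" .
    qed
    also have "even \<dots>"
      using less.IH n by (intro dvd_sum dvd_mult2) auto
    finally show ?thesis .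
  qed
qed

text \<open>An even total means that the true and the false counts agree modulo 2 at each size, so
  \<open>p\<close> and \<open>q\<close> may both be replaced by \<open>False\<close>.\<close>

lemma even_convolution_value_trees:
  "even (\<Sum>i = 1..n - 1. card (value_trees c p i) * card (value_trees c q (n - i))) \<longleftrightarrow>
    even (\<Sum>i = 1..n - 1. card (value_trees c False i) * card (value_trees c False (n - i)))"
proof (rule even_sum_cong)
  have *: "even (card (value_trees c s i)) \<longleftrightarrow> even (card (value_trees c False i))" if "i \<ge> 1" for s i
    using even_card_value_trees[OF that, of c] by (cases s) auto
  fix i
  assume "i \<in> {1..n - 1}"
  then have "i \<ge> 1" "n - i \<ge> 1"
    by auto
  then show "even (card (value_trees c p i) * card (value_trees c q (n - i))) \<longleftrightarrow>
      even (card (value_trees c False i) * card (value_trees c False (n - i)))"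
    using *[of i p] *[of "n - i" q] by simp
qed

text \<open>With a single falsifying pair the recurrence for the false count is one convolution.
  Modulo 2 it is a self-convolution, so the count obeys the same halving rule as the Catalan
  numbers, and both are 1 at \<open>n = 1\<close>.\<close>

lemma odd_card_value_trees_iff:
  assumes c: "{(p, q). \<not> c p q} = {(p\<^sub>0, q\<^sub>0)}" and "n \<ge> 1"
  shows "odd (card (value_trees c False n)) \<longleftrightarrow> odd (catalan n)"
  using \<open>n \<ge> 1\<close>
proof (induction n rule: less_induct)
  case (less n)
  show ?case
  proof (cases "n = 1")
    case True
    then show ?thesis
      using value_trees_1[of c] by (simp add: catalan_def)
  next
    case False
    with less.prems have n: "n \<ge> 2"
      by simp
    have "odd (card (value_trees c False n)) \<longleftrightarrow>
        odd (\<Sum>i = 1..n - 1. card (value_trees c p\<^sub>0 i) * card (value_trees c q\<^sub>0 (n - i)))"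
      using c by (simp add: card_value_trees[OF n])
    also have "\<dots> \<longleftrightarrow> even n \<and> odd (card (value_trees c False (n div 2)))"
      unfolding even_convolution_value_trees[of c p\<^sub>0] by (rule odd_self_convolution_iff[OF n])
    also have "\<dots> \<longleftrightarrow> even n \<and> odd (catalan (n div 2))"
      using less.IH[of "n div 2"] n by auto
    also have "\<dots> \<longleftrightarrow> odd (catalan n)"
      using odd_catalan_iff[OF n] by simp
    finally show ?thesis .
  qed
qed

theorem theorem8p1:
  fixes c :: "bool \<Rightarrow> bool \<Rightarrow> bool" and n :: nat
  assumes "c \<in> {imp, imp_neg, neg_imp, neg_imp_neg}"
    and "n \<ge> 2"
  shows "(odd (\<Sum>i = 1..n - 1. false_rows c i * false_rows c (n - i)) \<longleftrightarrow> odd (catalan n))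
    \<and> (odd (\<Sum>i = 1..n - 1. false_rows c i * true_rows c (n - i)) \<longleftrightarrow> odd (catalan n))
    \<and> (odd (\<Sum>i = 1..n - 1. true_rows c i * false_rows c (n - i)) \<longleftrightarrow> odd (catalan n))
    \<and> (odd (\<Sum>i = 1..n - 1. true_rows c i * true_rows c (n - i)) \<longleftrightarrow> odd (catalan n))"
proof -
  \<comment> \<open>On the left \<open>p\<close> and \<open>q\<close> are bound by the
    comprehension; on the right they are the obtained arguments at which the connective is
    false.\<close>
  obtain p q where c: "{(p, q). \<not> c p q} = {(p, q)}"
  proof -
    have "{(p, q). \<not> imp p q} = {(True, False)}" "{(p, q). \<not> imp_neg p q} = {(True, True)}"
      "{(p, q). \<not> neg_imp p q} = {(False, False)}" "{(p, q). \<not> neg_imp_neg p q} = {(False, True)}"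
      by (auto simp: imp_def imp_neg_def neg_imp_def neg_imp_neg_def)
    with assms(1) that show thesis
      by auto
  qed
  have rows: "false_rows c m = card (value_trees c False m)"
    "true_rows c m = card (value_trees c True m)" for m
    using card_rows_value[of m c False] card_rows_value[of m c True]
    by (simp_all add: false_rows_def true_rows_def)
  have "odd (\<Sum>i = 1..n - 1. card (value_trees c r i) * card (value_trees c s (n - i)))
      \<longleftrightarrow> odd (catalan n)" for r s
  proof -
    \<comment> \<open>All four convolutions share one parity, so the one at the falsifying pair can
      stand for any of them; by the recurrence it equals the false count.\<close>
    have "odd (\<Sum>i = 1..n - 1. card (value_trees c r i) * card (value_trees c s (n - i))) \<longleftrightarrow>
        odd (\<Sum>i = 1..n - 1. card (value_trees c p i) * card (value_trees c q (n - i)))"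
      by (simp only: even_convolution_value_trees[of c r s] even_convolution_value_trees[of c p q])
    also have "\<dots> \<longleftrightarrow> odd (card (value_trees c False n))"
      using c by (simp add: card_value_trees[OF assms(2)])
    also have "\<dots> \<longleftrightarrow> odd (catalan n)"
      using odd_card_value_trees_iff[OF c] assms(2) by simp
    finally show ?thesis .
  qed
  then show ?thesis
    unfolding rows by blast
qed

end
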